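(* If $P(\cdot)$ is the minimum isoperimetric function of a finite presentation $\langle A;R\rangle$ and $d(\cdot)$ is the minimum isodiametric function of that presentation, then for all $n$ $$P(n)\le n\,2^{\,C\,c^{d(n)}},$$ where $C=2\,(2|A|+1)\,\|R\|^2$ and $c=(2|A|)^2$.
   Context: $A$ is a finite alphabet, $A^{-1}$ a disjoint copy, $A^{\pm1}=A\cup A^{-1}$, $(A^{\pm1})^*$ the set of words over $A^{\pm1}$, $|w|$ the length of a word, $|A|$ the cardinality of $A$. $R\subset(A^{\pm1})^*$ is finite and does not contain the empty word; $\|R\|=\sum_{r\in R}|r|$; $R^{\pm1}=R\cup\{r^{-1}:r\in R\}$; $x^y=y^{-1}xy$. $=_{\mathrm{FG}}$ is equality in the free group on $A$ and $=_{\langle A;R\rangle}$ equality in the presented group. An isoperimetric function of $\langle A;R\rangle$ is any $P:\mathbb N\to\mathbb N$ such that every word $w$ with $w=_{\langle A;R\rangle}1$ satisfies $w=_{\mathrm{FG}}\prod_{i\in I}r_i^{x_i}$ for some finite sequence of $r_i\in R^{\pm1}$ and words $x_i\in(A^{\pm1})^*$ with $|I|\le P(|w|)$. An isodiametric function is any $D:\mathbb N\to\mathbb N$ such that every word $w$ with $w=_{\langle A;R\rangle}1$ satisfies $w=_{\mathrm{FG}}\prod_{i\in I}r_i^{x_i}$ for some finite sequence of $r_i\in R^{\pm1}$ and words $x_i$ with $|x_i|\le D(|w|)$ for all $i\in I$. The minimum such functions are the pointwise smallest ones. *)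

theory Defs
  imports Main
begin

(* The letter (a, True) stands for a and (a, False) for a^-1. *)
type_synonym 'a letter = "'a \<times> bool"
type_synonym 'a word = "'a letter list"

definition words :: "'a set \<Rightarrow> 'a word set" where
  "words A = lists (A \<times> UNIV)"

definition inv_letter :: "'a letter \<Rightarrow> 'a letter" where
  "inv_letter s = (fst s, \<not> snd s)"

definition inv_word :: "'a word \<Rightarrow> 'a word" where
  "inv_word w = rev (map inv_letter w)"

definition conj_word :: "'a word \<Rightarrow> 'a word \<Rightarrow> 'a word" where
  "conj_word r x = inv_word x @ r @ x"

definition sym_rels :: "'a word set \<Rightarrow> 'a word set" where
  "sym_rels R = R \<union> inv_word ` R"

definition rels_norm :: "'a word set \<Rightarrow> nat" where
  "rels_norm R = (\<Sum>r\<in>R. length r)"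

(* Insertion of a trivial pair s s^-1 or of a relator.  The equivalence closure of this relation
   is the congruence on words whose quotient is the group presented by A and R. *)
inductive insertion :: "'a set \<Rightarrow> 'a word set \<Rightarrow> 'a word \<Rightarrow> 'a word \<Rightarrow> bool"
  for A :: "'a set" and R :: "'a word set" where
  pair: "s \<in> A \<times> UNIV \<Longrightarrow> insertion A R (u @ v) (u @ [s, inv_letter s] @ v)"
| relator: "r \<in> R \<Longrightarrow> insertion A R (u @ v) (u @ r @ v)"

definition group_eq :: "'a set \<Rightarrow> 'a word set \<Rightarrow> 'a word \<Rightarrow> 'a word \<Rightarrow> bool" where
  "group_eq A R = equivclp (insertion A R)"

abbreviation free_eq :: "'a set \<Rightarrow> 'a word \<Rightarrow> 'a word \<Rightarrow> bool" where
  "free_eq A \<equiv> group_eq A {}"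

(* A list [(r_1, x_1), ..., (r_m, x_m)] encodes the product of the conjugates r_i^x_i. *)
definition is_conj_product ::
  "'a set \<Rightarrow> 'a word set \<Rightarrow> 'a word \<Rightarrow> ('a word \<times> 'a word) list \<Rightarrow> bool" where
  "is_conj_product A R w ps \<longleftrightarrow>
     set ps \<subseteq> sym_rels R \<times> words A \<and>
     free_eq A w (concat (map (\<lambda>(r, x). conj_word r x) ps))"

definition isoperimetric :: "'a set \<Rightarrow> 'a word set \<Rightarrow> (nat \<Rightarrow> nat) \<Rightarrow> bool" where
  "isoperimetric A R P \<longleftrightarrow>
     (\<forall>w\<in>words A. group_eq A R w [] \<longrightarrow>
        (\<exists>ps. is_conj_product A R w ps \<and> length ps \<le> P (length w)))"

definition isodiametric :: "'a set \<Rightarrow> 'a word set \<Rightarrow> (nat \<Rightarrow> nat) \<Rightarrow> bool" where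
  "isodiametric A R D \<longleftrightarrow>
     (\<forall>w\<in>words A. group_eq A R w [] \<longrightarrow>
        (\<exists>ps. is_conj_product A R w ps \<and> (\<forall>(r, x)\<in>set ps. length x \<le> D (length w))))"

definition min_isoperimetric :: "'a set \<Rightarrow> 'a word set \<Rightarrow> (nat \<Rightarrow> nat) \<Rightarrow> bool" where
  "min_isoperimetric A R P \<longleftrightarrow>
     isoperimetric A R P \<and> (\<forall>Q. isoperimetric A R Q \<longrightarrow> (\<forall>n. P n \<le> Q n))"

definition min_isodiametric :: "'a set \<Rightarrow> 'a word set \<Rightarrow> (nat \<Rightarrow> nat) \<Rightarrow> bool" where
  "min_isodiametric A R D \<longleftrightarrow>
     isodiametric A R D \<and> (\<forall>E. isodiametric A R E \<longrightarrow> (\<forall>n. D n \<le> E n))"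

end

theory Submission
  imports Defs
begin

text \<open>
  Fix \<open>n\<close> and let \<open>H\<close> be the subgroup of the free group generated by the conjugates \<open>r\<^sup>x\<close> with
  \<open>|x| \<le> d(n)\<close>.  Their prefixes form a finite set \<open>X\<close> of vertices in the Cayley graph of the
  free group, and Stallings folding identifies vertices of \<open>X\<close> lying in the same coset of \<open>H\<close>
  until the quotient is deterministic.  Each identification joins two classes, so if two vertices
  \<open>p, q\<close> of one class always have \<open>p q\<^sup>-\<^sup>1\<close> equal to a product of at most \<open>k\<close> conjugates of relators,
  then after the identification this holds with \<open>3 k\<close>.  Hence the final constant is at most
  \<open>3\<close> to the power \<open>|X|\<close>.  The reduced form of a word of length \<open>n\<close> trivial in the presented group
  labels a loop in the folded graph, and going around it costs one such constant per letter.
\<close>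

section \<open>Free reduction\<close>

text \<open>Left multiplication of a normal form by one letter. Letting the letters act on reduced
  words (van der Waerden's trick) gives unique normal forms without a confluence argument.\<close>

definition cancel_cons :: "'a letter \<Rightarrow> 'a word \<Rightarrow> 'a word" where
  "cancel_cons s w = (case w of [] \<Rightarrow> [s] | t # w' \<Rightarrow> if t = inv_letter s then w' else s # w)"

definition reduce :: "'a word \<Rightarrow> 'a word" where
  "reduce w = foldr cancel_cons w []"

definition reduced :: "'a word \<Rightarrow> bool" where
  "reduced = successively (\<lambda>s t. t \<noteq> inv_letter s)"

lemma inv_letter_inv_letter [simp]: "inv_letter (inv_letter s) = s"
  by (simp add: inv_letter_def)

lemma inv_letter_mem [simp]: "inv_letter s \<in> A \<times> UNIV \<longleftrightarrow> s \<in> A \<times> UNIV"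
  by (cases s) (simp add: inv_letter_def)

lemma inv_word_Nil [simp]: "inv_word [] = []"
  by (simp add: inv_word_def)

lemma inv_word_Cons [simp]: "inv_word (s # w) = inv_word w @ [inv_letter s]"
  by (simp add: inv_word_def)

lemma inv_word_append [simp]: "inv_word (u @ v) = inv_word v @ inv_word u"
  by (simp add: inv_word_def)

lemma inv_word_inv_word [simp]: "inv_word (inv_word w) = w"
  by (induction w) auto

lemma length_inv_word [simp]: "length (inv_word w) = length w"
  by (simp add: inv_word_def)

lemma words_Nil [simp]: "[] \<in> words A"
  by (simp add: words_def)

lemma words_Cons [simp]: "s # w \<in> words A \<longleftrightarrow> s \<in> A \<times> UNIV \<and> w \<in> words A"
  by (simp add: words_def)

lemma words_append [simp]: "u @ v \<in> words A \<longleftrightarrow> u \<in> words A \<and> v \<in> words A"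
  by (induction u) auto

lemma inv_word_words [simp]: "inv_word w \<in> words A \<longleftrightarrow> w \<in> words A"
  by (induction w) auto

lemma conj_word_words [simp]: "conj_word r x \<in> words A \<longleftrightarrow> r \<in> words A \<and> x \<in> words A"
  by (auto simp: conj_word_def)

lemma inv_conj_word: "inv_word (conj_word r x) = conj_word (inv_word r) x"
  by (simp add: conj_word_def)

lemma reduced_cancel_cons: "reduced w \<Longrightarrow> reduced (cancel_cons s w)"
  by (cases w) (auto simp: cancel_cons_def reduced_def successively_Cons)

text \<open>If \<open>w\<close> begins with \<open>s\<close>, the inner call removes it, and
  reducedness keeps the outer call from cancelling against the next letter. Hence every letter
  permutes the reduced words.\<close>

lemma cancel_cons_inverse: "reduced w \<Longrightarrow> cancel_cons s (cancel_cons (inv_letter s) w) = w"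
  by (cases w rule: remdups_adj.cases) (auto simp: cancel_cons_def reduced_def)

lemma reduced_foldr: "reduced z \<Longrightarrow> reduced (foldr cancel_cons w z)"
  by (induction w) (auto intro: reduced_cancel_cons)

lemma reduced_reduce: "reduced (reduce w)"
  unfolding reduce_def by (rule reduced_foldr) (simp add: reduced_def)

lemma foldr_cancel_cons:
  assumes "reduced z"
  shows "foldr cancel_cons (cancel_cons s w) z = cancel_cons s (foldr cancel_cons w z)"
proof (cases w)
  case (Cons t w')
  have "cancel_cons s w = (if t = inv_letter s then w' else s # w)"
    by (simp add: Cons cancel_cons_def)
  then show ?thesis
    using cancel_cons_inverse[OF reduced_foldr[OF assms], of s w'] Cons by simp
qed (simp add: cancel_cons_def)

text \<open>A word and its normal form act alike on reduced words, so normal forms respect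
  concatenation.\<close>

lemma foldr_reduce: "reduced z \<Longrightarrow> foldr cancel_cons (reduce w) z = foldr cancel_cons w z"
  by (induction w) (simp_all add: reduce_def foldr_cancel_cons)

lemma reduce_append: "reduce (u @ v) = foldr cancel_cons u (reduce v)"
  by (simp add: reduce_def)

lemma reduce_Nil [simp]: "reduce [] = []"
  by (simp add: reduce_def)

lemma reduce_Cons: "reduce (s # w) = cancel_cons s (reduce w)"
  by (simp add: reduce_def)

lemma reduce_reduce [simp]: "reduce (reduce w) = reduce w"
  using foldr_reduce[of "[]" w] by (simp add: reduce_def reduced_def)

lemma reduce_append_cong:
  assumes "reduce u = reduce u'" "reduce v = reduce v'"
  shows "reduce (u @ v) = reduce (u' @ v')"
  by (metis assms foldr_reduce reduce_append reduced_reduce)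

lemma reduce_pair: "reduce (u @ [s, inv_letter s] @ v) = reduce (u @ v)"
  by (simp add: reduce_append reduce_Cons cancel_cons_inverse reduced_reduce)

lemma reduce_cancel: "reduce (u @ w @ inv_word w @ v) = reduce (u @ v)"
proof (induction w arbitrary: u v)
  case (Cons s w)
  then show ?case
    using Cons.IH[of "u @ [s]" "[inv_letter s] @ v"] reduce_pair[of u s v] by simp
qed simp

lemma reduce_cancel': "reduce (u @ inv_word w @ w @ v) = reduce (u @ v)"
  using reduce_cancel[of u "inv_word w" v] by simp

text \<open>The group computation u^-1 = u^-1 v v^-1 = u^-1 u v^-1 = v^-1.\<close>

lemma reduce_inv_word_cong:
  assumes "reduce u = reduce v"
  shows "reduce (inv_word u) = reduce (inv_word v)"
proof -
  have "reduce (inv_word u) = reduce (inv_word u @ v @ inv_word v)"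
    using reduce_cancel[of "inv_word u" v "[]"] by simp
  also have "\<dots> = reduce (inv_word u @ u @ inv_word v)"
    by (intro reduce_append_cong refl assms[symmetric])
  also have "\<dots> = reduce (inv_word v)"
    using reduce_cancel'[of "[]" u "inv_word v"] by simp
  finally show ?thesis .
qed

lemma length_reduce: "length (reduce w) \<le> length w"
proof (induction w)
  case (Cons s w)
  have "length (cancel_cons s v) \<le> Suc (length v)" for v
    by (cases v) (auto simp: cancel_cons_def)
  from this[of "reduce w"] Cons show ?case by (simp add: reduce_Cons)
qed simp

section \<open>Equality in the free group as equality of normal forms\<close>

lemma free_eq_imp_reduce_eq:
  assumes "free_eq A u v"
  shows "reduce u = reduce v"
  using assms unfolding group_eq_def
proof (induction rule: equivclp_induct)
  case (step y z)
  have "insertion A {} a b \<Longrightarrow> reduce a = reduce b" for a b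
    by (induction rule: insertion.induct) (simp_all only: reduce_pair empty_iff)
  with step show ?case by metis
qed simp

lemma insertion_Cons: "insertion A R u v \<Longrightarrow> insertion A R (s # u) (s # v)"
  by (induction rule: insertion.induct) (metis append_Cons insertion.intros)+

lemma group_eq_Cons: "group_eq A R u v \<Longrightarrow> group_eq A R (s # u) (s # v)"
  unfolding group_eq_def
proof (induction rule: equivclp_induct)
  case (step y z)
  then show ?case by (meson equivclp_into_equivclp insertion_Cons)
qed simp

text \<open>Each cancellation undoes the insertion of a trivial pair, which is permitted only for
  letters over \<open>A\<close>.\<close>

lemma free_eq_reduce: "w \<in> words A \<Longrightarrow> free_eq A w (reduce w)"
proof (induction w)
  case Nil
  then show ?case by (simp add: group_eq_def)
next
  case (Cons s w)
  have 1: "free_eq A (s # w) (s # reduce w)"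
    using Cons by (intro group_eq_Cons) simp
  have "free_eq A (s # v) (cancel_cons s v)" for v
  proof (cases "\<exists>v'. v = inv_letter s # v'")
    case True
    then obtain v' where v: "v = inv_letter s # v'" by blast
    have "insertion A {} v' (s # v)"
      using insertion.pair[of s A "{}" "[]" v'] Cons.prems by (simp add: v)
    then show ?thesis
      by (simp add: v cancel_cons_def group_eq_def converse_r_into_equivclp)
  qed (auto simp: cancel_cons_def group_eq_def split: list.splits)
  then show ?case
    using 1 unfolding reduce_Cons group_eq_def by (meson equivclp_trans)
qed

lemma free_eq_iff_reduce_eq:
  assumes "u \<in> words A" "v \<in> words A"
  shows "free_eq A u v \<longleftrightarrow> reduce u = reduce v"
proof
  assume "reduce u = reduce v"
  then show "free_eq A u v"
    using free_eq_reduce[OF assms(1)] free_eq_reduce[OF assms(2)]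
    unfolding group_eq_def by (metis equivclp_sym equivclp_trans)
qed (rule free_eq_imp_reduce_eq)

section \<open>Products of boundedly many conjugates\<close>

abbreviation conj_product :: "('a word \<times> 'a word) list \<Rightarrow> 'a word" where
  "conj_product ps \<equiv> concat (map (\<lambda>(r, x). conj_word r x) ps)"

text \<open>Only the number of conjugates is counted; the conjugators may be arbitrarily long.
  Comparing normal forms avoids side conditions on the alphabet of \<open>w\<close>.\<close>

definition area_le :: "'a set \<Rightarrow> 'a word set \<Rightarrow> nat \<Rightarrow> 'a word \<Rightarrow> bool" where
  "area_le A R k w \<longleftrightarrow>
     (\<exists>ps. set ps \<subseteq> sym_rels R \<times> words A \<and> length ps \<le> k \<and> reduce w = reduce (conj_product ps))"

lemma area_le_mono: "area_le A R k w \<Longrightarrow> k \<le> l \<Longrightarrow> area_le A R l w"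
  unfolding area_le_def by (meson le_trans)

lemma area_le_cong: "area_le A R k u \<Longrightarrow> reduce u = reduce v \<Longrightarrow> area_le A R k v"
  unfolding area_le_def by metis

lemma area_le_0: "reduce w = [] \<Longrightarrow> area_le A R 0 w"
  unfolding area_le_def by (intro exI[of _ "[]"]) auto

lemma area_le_conj_word:
  assumes "r \<in> sym_rels R" "x \<in> words A"
  shows "area_le A R 1 (conj_word r x)"
  unfolding area_le_def by (intro exI[of _ "[(r, x)]"]) (use assms in auto)

lemma area_le_append:
  assumes "area_le A R k u" "area_le A R l v"
  shows "area_le A R (k + l) (u @ v)"
proof -
  from assms obtain ps qs where
    "set ps \<subseteq> sym_rels R \<times> words A" "length ps \<le> k" "reduce u = reduce (conj_product ps)"
    "set qs \<subseteq> sym_rels R \<times> words A" "length qs \<le> l" "reduce v = reduce (conj_product qs)"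
    unfolding area_le_def by metis
  then show ?thesis
    unfolding area_le_def
    by (intro exI[of _ "ps @ qs"]) (auto intro: reduce_append_cong)
qed

lemma sym_rels_inv: "r \<in> sym_rels R \<Longrightarrow> inv_word r \<in> sym_rels R"
  by (auto simp: sym_rels_def)

text \<open>Inverting a product reverses its factors and inverts each relator under the same
  conjugator, so the count is kept.\<close>

lemma area_le_inv_word:
  assumes "area_le A R k w"
  shows "area_le A R k (inv_word w)"
proof -
  from assms obtain ps where ps:
    "set ps \<subseteq> sym_rels R \<times> words A" "length ps \<le> k" "reduce w = reduce (conj_product ps)"
    unfolding area_le_def by metis
  let ?qs = "rev (map (\<lambda>(r, x). (inv_word r, x)) ps)"
  have "conj_product ?qs = inv_word (conj_product ps)"
    by (induction ps) (auto simp: inv_conj_word)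
  moreover have "set ?qs \<subseteq> sym_rels R \<times> words A"
    using ps(1) by (auto intro: sym_rels_inv)
  ultimately show ?thesis
    unfolding area_le_def using ps(2,3) reduce_inv_word_cong
    by (intro exI[of _ ?qs]) auto
qed

section \<open>Folding\<close>

text \<open>The colour classes are the vertices identified so far.\<close>

lemma ex_closed_colouring:
  fixes W :: "nat \<Rightarrow> 'v \<Rightarrow> 'v \<Rightarrow> bool" and B :: "('v \<times> 'v) set"
    and T :: "(('v \<times> 'v) \<times> ('v \<times> 'v)) set"
  assumes fin: "finite X"
    and refl: "\<And>p. W 0 p p"
    and sym: "\<And>k p q. W k p q \<Longrightarrow> W k q p"
    and trans: "\<And>k l p q r. W k p q \<Longrightarrow> W l q r \<Longrightarrow> W (k + l) p r"
    and mono: "\<And>k l p q. W k p q \<Longrightarrow> k \<le> l \<Longrightarrow> W l p q"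
    and B: "B \<subseteq> X \<times> X" "\<And>p q. (p, q) \<in> B \<Longrightarrow> W 1 p q"
    and T: "T \<subseteq> (X \<times> X) \<times> (X \<times> X)"
      "\<And>k p q p' q'. ((p, q), (p', q')) \<in> T \<Longrightarrow> W k p q \<Longrightarrow> W k p' q'"
  obtains f :: "'v \<Rightarrow> 'v" where
    "\<And>p q. p \<in> X \<Longrightarrow> q \<in> X \<Longrightarrow> f p = f q \<Longrightarrow> W (3 ^ card X) p q"
    "\<And>p q. (p, q) \<in> B \<Longrightarrow> f p = f q"
    "\<And>p q p' q'. ((p, q), (p', q')) \<in> T \<Longrightarrow> f p = f q \<Longrightarrow> f p' = f q'"
proof -
  \<comment> \<open>The exponent counts the colours lost since the identity colouring; each merge
    loses one and triples the cost.\<close>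
  define bounded where "bounded f \<longleftrightarrow>
    (\<forall>p\<in>X. \<forall>q\<in>X. f p = f q \<longrightarrow> W (3 ^ (card X - card (f ` X))) p q)" for f :: "'v \<Rightarrow> 'v"
  define closed where "closed f \<longleftrightarrow> (\<forall>p q. (p, q) \<in> B \<longrightarrow> f p = f q) \<and>
    (\<forall>p q p' q'. ((p, q), (p', q')) \<in> T \<longrightarrow> f p = f q \<longrightarrow> f p' = f q')" for f :: "'v \<Rightarrow> 'v"
  have "bounded f \<Longrightarrow> \<exists>g. bounded g \<and> closed g" for f
  proof (induction "card (f ` X)" arbitrary: f rule: less_induct)
    case less
    show ?case
    proof (cases "closed f")
      case False
      define k where "k = (3::nat) ^ (card X - card (f ` X))"
      have W: "W k p q" if "p \<in> X" "q \<in> X" "f p = f q" for p q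
        using less.prems that unfolding bounded_def k_def by blast
      have "1 \<le> k" by (simp add: k_def)
      \<comment> \<open>A violated condition supplies differently coloured points at cost
        \<open>k\<close>: a pair of \<open>B\<close> costs 1, and \<open>T\<close> carries over the
        cost of a pair that already shares a colour.\<close>
      obtain p q where pq: "p \<in> X" "q \<in> X" "f p \<noteq> f q" "W k p q"
      proof -
        from False consider p q where "(p, q) \<in> B" "f p \<noteq> f q"
          | p q p' q' where "((p, q), (p', q')) \<in> T" "f p = f q" "f p' \<noteq> f q'"
          unfolding closed_def by blast
        then show thesis
        proof cases
          case 1
          then show ?thesis using that[of p q] B(1) mono[OF B(2) \<open>1 \<le> k\<close>] by blast
        next
          case 2
          then have "p \<in> X" "q \<in> X" "p' \<in> X" "q' \<in> X" using T(1) by blast+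
          then show ?thesis using that[of p' q'] 2 T(2)[OF 2(1) W] by blast
        qed
      qed
      define g where "g x = (if f x = f q then f p else f x)" for x
      have "g ` X \<subseteq> f ` X - {f q}" using pq by (auto simp: g_def)
      then have "card (g ` X) \<le> card (f ` X - {f q})"
        using fin by (intro card_mono) auto
      also have "\<dots> < card (f ` X)"
        using fin pq by (intro card_Diff1_less) auto
      finally have less_card: "card (g ` X) < card (f ` X)" .
      have "card (f ` X) \<le> card X" using fin by (rule card_image_le)
      then have "Suc (card X - card (f ` X)) \<le> card X - card (g ` X)"
        using less_card by linarith
      then have "(3::nat) ^ Suc (card X - card (f ` X)) \<le> 3 ^ (card X - card (g ` X))"
        by (intro power_increasing) auto
      then have k3: "k + k + k \<le> 3 ^ (card X - card (g ` X))"
        by (simp add: k_def)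
      \<comment> \<open>The route from \<open>x\<close> through \<open>p\<close> and
        \<open>q\<close> to \<open>y\<close> has three legs of cost \<open>k\<close>: two inside old
        classes and the new identification between them.\<close>
      have far: "W (k + k + k) x y" if "x \<in> X" "y \<in> X" "f x = f p" "f y = f q" for x y
        using trans[OF trans[OF W[of x p] pq(4)] W[of q y]] that pq by simp
      have near: "W (k + k + k) x y" if "x \<in> X" "y \<in> X" "f x = f y" for x y
        using mono[OF W[OF that]] by simp
      have "W (k + k + k) x y" if "x \<in> X" "y \<in> X" "g x = g y" for x y
        using that far[of x y] sym[OF far[of y x]] near[of x y]
        by (auto simp: g_def split: if_splits)
      then have "bounded g"
        unfolding bounded_def using mono[OF _ k3] by blast
      with less.hyps[OF less_card] show ?thesis .
    qed (use less.prems in blast)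
  qed
  moreover have "bounded id"
    by (auto simp: bounded_def intro: mono[OF refl])
  ultimately obtain f where f: "bounded f" "closed f" by blast
  have "(3::nat) ^ (card X - card (f ` X)) \<le> 3 ^ card X"
    by (intro power_increasing) auto
  then have "W (3 ^ card X) p q" if "p \<in> X" "q \<in> X" "f p = f q" for p q
    using f(1) that mono unfolding bounded_def by blast
  then show thesis
    using that[of f] f(2) unfolding closed_def by blast
qed

text \<open>
  Paths in the folded graph, whose vertices are the colours of the free group elements in \<open>X\<close>.
\<close>

definition folded_edge :: "'a word set \<Rightarrow> ('a word \<Rightarrow> 'c) \<Rightarrow> 'c \<Rightarrow> 'a letter \<Rightarrow> 'c \<Rightarrow> bool" where
  "folded_edge X f a s b \<longleftrightarrow> (\<exists>p\<in>X. reduce (p @ [s]) \<in> X \<and> f p = a \<and> f (reduce (p @ [s])) = b)"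

fun folded_path :: "'a word set \<Rightarrow> ('a word \<Rightarrow> 'c) \<Rightarrow> 'c \<Rightarrow> 'a word \<Rightarrow> 'c \<Rightarrow> bool" where
  "folded_path X f a [] b \<longleftrightarrow> a = b"
| "folded_path X f a (s # w) b \<longleftrightarrow> (\<exists>c. folded_edge X f a s c \<and> folded_path X f c w b)"

lemma folded_path_append:
  "folded_path X f a (u @ v) b \<longleftrightarrow> (\<exists>c. folded_path X f a u c \<and> folded_path X f c v b)"
  by (induction u arbitrary: a) auto

text \<open>As \<open>p\<close> is in normal form, reading \<open>s\<close> and then its inverse
  leads back to exactly this representative.\<close>

lemma folded_edge_inv:
  assumes "\<And>p. p \<in> X \<Longrightarrow> reduce p = p" "folded_edge X f a s b"
  shows "folded_edge X f b (inv_letter s) a"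
proof -
  from assms(2) obtain p where p: "p \<in> X" "reduce (p @ [s]) \<in> X" "f p = a" "f (reduce (p @ [s])) = b"
    by (auto simp: folded_edge_def)
  have "reduce (reduce (p @ [s]) @ [inv_letter s]) = reduce (p @ [s] @ [inv_letter s])"
    using reduce_append_cong[of "reduce (p @ [s])" "p @ [s]"] by simp
  also have "\<dots> = p"
    using reduce_pair[of p s "[]"] assms(1)[OF p(1)] by simp
  finally show ?thesis
    using p by (auto simp: folded_edge_def intro!: bexI[of _ "reduce (p @ [s])"])
qed

lemma folded_path_inv_word:
  assumes "\<And>p. p \<in> X \<Longrightarrow> reduce p = p"
  shows "folded_path X f a w b \<Longrightarrow> folded_path X f b (inv_word w) a"
proof (induction w arbitrary: a)
  case (Cons s w)
  then obtain e where "folded_edge X f a s e" "folded_path X f b (inv_word w) e" by auto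
  then show ?case
    using folded_edge_inv[OF assms, of X f a s e] by (auto simp: folded_path_append)
qed simp

text \<open>In a deterministic graph, a letter followed by its inverse leads back to the same
  vertex, so such detours can be cut out of a path.\<close>

lemma folded_path_reduce:
  assumes nf: "\<And>p. p \<in> X \<Longrightarrow> reduce p = p"
    and det: "\<And>s a b c. s \<in> A \<times> UNIV \<Longrightarrow> folded_edge X f a s b \<Longrightarrow> folded_edge X f a s c \<Longrightarrow> b = c"
  shows "w \<in> words A \<Longrightarrow> folded_path X f a w b \<Longrightarrow> folded_path X f a (reduce w) b"
proof (induction w arbitrary: a)
  case (Cons s w)
  then obtain c where c: "folded_edge X f a s c" "folded_path X f c (reduce w) b" by auto
  show ?case
  proof (cases "\<exists>v. reduce w = inv_letter s # v")
    case True
    then obtain v where v: "reduce w = inv_letter s # v" by blast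
    with c obtain e where "folded_edge X f c (inv_letter s) e" "folded_path X f e v b" by auto
    \<comment> \<open>The first edge read backwards also leaves \<open>c\<close> with the label
      \<open>inv_letter s\<close>.\<close>
    moreover have "e = a"
      using det[of "inv_letter s"] folded_edge_inv[OF nf c(1)] calculation(1) Cons.prems(1) by auto
    ultimately show ?thesis by (simp add: reduce_Cons v cancel_cons_def)
  qed (use c in \<open>auto simp: reduce_Cons cancel_cons_def split: list.splits\<close>)
qed simp

text \<open>A path in the Cayley graph projects to the folded graph as long as it stays inside
  \<open>X\<close>.\<close>

lemma folded_path_of_prefixes:
  assumes "\<And>i. i \<le> length w \<Longrightarrow> reduce (u @ take i w) \<in> X"
  shows "folded_path X f (f (reduce u)) w (f (reduce (u @ w)))"
  using assms
proof (induction w rule: rev_induct)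
  case (snoc s w)
  have pre: "reduce (u @ take i w) \<in> X" if "i \<le> length w" for i
    using snoc.prems[of i] that by simp
  have "reduce (u @ w @ [s]) \<in> X"
    using snoc.prems[of "Suc (length w)"] by simp
  moreover have "reduce (reduce (u @ w) @ [s]) = reduce (u @ w @ [s])"
    using reduce_append_cong[of "reduce (u @ w)" "u @ w" "[s]" "[s]"] by simp
  ultimately have "folded_edge X f (f (reduce (u @ w))) s (f (reduce (u @ w @ [s])))"
    using pre[of "length w"] unfolding folded_edge_def
    by (intro bexI[of _ "reduce (u @ w)"]) auto
  then show ?case
    using snoc.IH[OF pre] by (auto simp: folded_path_append)
qed simp

text \<open>A folded path lifts to edges of the Cayley graph separated by jumps between
  representatives of one class. There is a jump of cost \<open>L\<close> at each of its
  \<open>length w + 1\<close> vertices.\<close>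

lemma area_le_folded_path:
  assumes close: "\<And>p q. p \<in> X \<Longrightarrow> q \<in> X \<Longrightarrow> f p = f q \<Longrightarrow> area_le A R L (p @ inv_word q)"
    and "folded_path X f (f p) w (f q)" "p \<in> X" "q \<in> X"
  shows "area_le A R (L * (length w + 1)) (p @ w @ inv_word q)"
  using assms(2,3)
proof (induction w arbitrary: p)
  case Nil
  then show ?case using close[of p q] \<open>q \<in> X\<close> by simp
next
  case (Cons s w)
  then obtain p' where p': "p' \<in> X" "reduce (p' @ [s]) \<in> X" "f p' = f p"
    "folded_path X f (f (reduce (p' @ [s]))) w (f q)"
    by (auto simp: folded_edge_def)
  have "area_le A R L (p @ inv_word p')" using close p' Cons.prems by metis
  from area_le_append[OF this Cons.IH[OF p'(4,2)]]
  have *: "area_le A R (L * (length (s # w) + 1))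
      ((p @ inv_word p') @ (reduce (p' @ [s]) @ w @ inv_word q))"
    by (simp add: algebra_simps)
  have "reduce ((p @ inv_word p') @ (reduce (p' @ [s]) @ (w @ inv_word q)))
      = reduce ((p @ inv_word p') @ ((p' @ [s]) @ (w @ inv_word q)))"
    by (intro reduce_append_cong) simp_all
  also have "\<dots> = reduce (p @ (s # w) @ inv_word q)"
    using reduce_cancel'[of p p' "s # w @ inv_word q"] by simp
  finally show ?case using area_le_cong[OF *] by simp
qed

section \<open>The double exponential bound\<close>

definition short_words :: "'a set \<Rightarrow> nat \<Rightarrow> 'a word set" where
  "short_words A m = {u \<in> words A. length u \<le> m}"

text \<open>The empty prefix is common to all relators; splitting it off lets the count be
  \<open>rels_norm R + 1\<close>.\<close>

definition relator_prefixes :: "'a word set \<Rightarrow> 'a word set" where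
  "relator_prefixes R = insert [] (\<Union>r\<in>R. (\<lambda>i. take i r) ` {1..length r})"

text \<open>Here \<open>u\<close> stands for a prefix of the inverse of a conjugator: the loop of a
  conjugate runs along the inverse of \<open>x\<close>, around \<open>r\<close>, and back along
  \<open>x\<close>.\<close>

definition fold_vertices :: "'a set \<Rightarrow> 'a word set \<Rightarrow> nat \<Rightarrow> 'a word set" where
  "fold_vertices A R m = (\<lambda>(u, v). reduce (u @ v)) ` (short_words A m \<times> relator_prefixes R)"

lemma short_words_eq: "short_words A m = {u. set u \<subseteq> A \<times> UNIV \<and> length u \<le> m}"
  by (auto simp: short_words_def words_def)

lemma finite_short_words: "finite A \<Longrightarrow> finite (short_words A m)"
  unfolding short_words_eq by (intro finite_lists_length_le) simp

text \<open>A geometric series with ratio at least 2; the added 1 makes the induction close.\<close>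

lemma card_short_words:
  assumes "finite A" "A \<noteq> {}"
  shows "card (short_words A m) + 1 \<le> 2 * (2 * card A) ^ m"
proof -
  have "card (short_words A m) = (\<Sum>i\<le>m. (2 * card A) ^ i)"
    unfolding short_words_eq using assms
    by (subst card_lists_length_le) (simp_all add: card_cartesian_product mult.commute)
  moreover have geometric: "(\<Sum>i\<le>m. k ^ i) + 1 \<le> 2 * k ^ m" if "2 \<le> k" for k :: nat
  proof (induction m)
    case (Suc m)
    have "2 * k ^ m \<le> k ^ Suc m" using that by simp
    with Suc.IH show ?case by (simp only: sum.atMost_Suc)
  qed simp
  moreover have "card A \<ge> 1" using assms by (simp add: Suc_le_eq card_gt_0_iff)
  ultimately show ?thesis using geometric[of "2 * card A"] by linarith
qed

lemma finite_relator_prefixes: "finite R \<Longrightarrow> finite (relator_prefixes R)"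
  by (simp add: relator_prefixes_def)

lemma card_relator_prefixes:
  assumes "finite R"
  shows "card (relator_prefixes R) \<le> rels_norm R + 1"
proof -
  have "card (\<Union>r\<in>R. (\<lambda>i. take i r) ` {1..length r}) \<le> (\<Sum>r\<in>R. card ((\<lambda>i. take i r) ` {1..length r}))"
    using assms by (rule card_UN_le)
  also have "\<dots> \<le> (\<Sum>r\<in>R. length r)"
    by (intro sum_mono) (metis card_image_le card_atLeastAtMost diff_Suc_1 finite_atLeastAtMost)
  finally have "card (\<Union>r\<in>R. (\<lambda>i. take i r) ` {1..length r}) \<le> rels_norm R"
    by (simp add: rels_norm_def)
  moreover have "finite (\<Union>r\<in>R. (\<lambda>i. take i r) ` {1..length r})" using assms by auto
  ultimately show ?thesis
    unfolding relator_prefixes_def by (simp add: card_insert_if)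
qed

text \<open>The squares are generous and chosen to fit the final \<open>C\<close> and
  \<open>c\<close>. The added 1 later absorbs one more factor 3.\<close>

lemma card_fold_vertices:
  assumes "finite A" "finite R" "A \<noteq> {}" "rels_norm R > 0"
  shows "card (fold_vertices A R m) + 1 \<le> 3 * (rels_norm R)\<^sup>2 * ((2 * card A) ^ m)\<^sup>2"
proof -
  define M N \<rho> where "M = (2 * card A) ^ m" and "N = card (short_words A m)" and "\<rho> = rels_norm R"
  have "M \<ge> 1" using assms by (simp add: M_def Suc_le_eq card_gt_0_iff)
  have "\<rho> \<ge> 1" using assms by (simp add: \<rho>_def)
  have "N + 1 \<le> 2 * M" using card_short_words[OF assms(1,3)] by (simp add: N_def M_def)
  \<comment> \<open>This is (M - 1)^2 >= 0.\<close>
  also have "2 * M \<le> M\<^sup>2 + 1"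
    using \<open>M \<ge> 1\<close> by (cases M) (auto simp: power2_eq_square)
  finally have N: "N \<le> M\<^sup>2" by simp
  have \<rho>: "\<rho> + 1 \<le> 2 * \<rho>\<^sup>2"
    using \<open>\<rho> \<ge> 1\<close> by (cases \<rho>) (auto simp: power2_eq_square)
  have "card (fold_vertices A R m) \<le> card (short_words A m \<times> relator_prefixes R)"
    unfolding fold_vertices_def using assms
    by (intro card_image_le) (simp add: finite_short_words finite_relator_prefixes)
  also have "\<dots> \<le> N * (\<rho> + 1)"
    using card_relator_prefixes[OF assms(2)]
    by (simp only: card_cartesian_product N_def \<rho>_def mult_le_mono2)
  also have "\<dots> \<le> M\<^sup>2 * (2 * \<rho>\<^sup>2)"
    using N \<rho> by (rule mult_le_mono)
  finally have "card (fold_vertices A R m) \<le> 2 * (\<rho>\<^sup>2 * M\<^sup>2)" by (simp add: mult_ac)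
  moreover have "1 \<le> \<rho>\<^sup>2 * M\<^sup>2" using \<open>M \<ge> 1\<close> \<open>\<rho> \<ge> 1\<close> by simp
  ultimately have "card (fold_vertices A R m) + 1 \<le> 3 * (\<rho>\<^sup>2 * M\<^sup>2)" by linarith
  then show ?thesis by (simp only: M_def \<rho>_def mult.assoc)
qed

text \<open>The number of factors in \<open>ps\<close> does not enter the bound: \<open>ps\<close>
  serves only to show that the reduced form of \<open>w\<close> labels a loop in a graph whose size
  depends on \<open>m\<close>.\<close>

lemma area_le_of_bounded_conjugators:
  assumes "finite A" "finite R" "R \<subseteq> words A" "w \<in> words A"
    and ps: "is_conj_product A R w ps" "\<forall>(r, x)\<in>set ps. length x \<le> m"
  shows "area_le A R (3 ^ card (fold_vertices A R m) * (length w + 1)) w"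
proof -
  define X where "X = fold_vertices A R m"
  have fin: "finite X"
    using assms by (simp add: X_def fold_vertices_def finite_short_words finite_relator_prefixes)
  have nf: "reduce p = p" if "p \<in> X" for p
    using that by (auto simp: X_def fold_vertices_def)
  have X1: "reduce u \<in> X" if "u \<in> short_words A m" for u
    unfolding X_def fold_vertices_def using that
    by (intro image_eqI[of _ _ "(u, [])"]) (auto simp: relator_prefixes_def)
  have X2: "reduce (u @ take i r) \<in> X" if "u \<in> short_words A m" "r \<in> R" "i \<le> length r" for u r i
  proof (cases "i = 0")
    case False
    then have "take i r \<in> (\<lambda>i. take i r) ` {1..length r}" using that by auto
    then have "take i r \<in> relator_prefixes R" using that unfolding relator_prefixes_def by blast
    with that show ?thesis unfolding X_def fold_vertices_def
      by (intro image_eqI[of _ _ "(u, take i r)"]) simp_all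
  qed (use X1 that in simp)
  \<comment> \<open>The word \<open>p @ inv_word q\<close> keeps its value in the free group when
    both points are multiplied on the right by one letter, so a folding move costs nothing
    extra.\<close>
  define W where "W k p q \<longleftrightarrow> area_le A R k (p @ inv_word q)" for k p q
  \<comment> \<open>\<open>B\<close> closes the relator loops, each at the cost of one conjugate;
    \<open>T\<close> lists the folding moves.\<close>
  define B where "B = {(reduce (u @ r), reduce u) | u r. u \<in> short_words A m \<and> r \<in> R}"
  define T where "T = {((p, q), (reduce (p @ [s]), reduce (q @ [s]))) | p q s.
    p \<in> X \<and> q \<in> X \<and> reduce (p @ [s]) \<in> X \<and> reduce (q @ [s]) \<in> X}"
  have cong: "reduce (reduce p @ inv_word (reduce q)) = reduce (p @ inv_word q)" for p q :: "'a word"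
    by (intro reduce_append_cong reduce_inv_word_cong) simp_all
  have W0: "W 0 p p" for p
    unfolding W_def using reduce_cancel[of "[]" p "[]"] by (intro area_le_0) simp
  have W_sym: "W k q p" if "W k p q" for k p q
    using area_le_inv_word[OF that[unfolded W_def]] by (simp add: W_def)
  have W_trans: "W (k + l) p r" if "W k p q" "W l q r" for k l p q r
    using area_le_cong[OF area_le_append[OF that[unfolded W_def]]] reduce_cancel'[of p q "inv_word r"]
    by (simp add: W_def)
  have W_mono: "W l p q" if "W k p q" "k \<le> l" for k l p q
    using that area_le_mono unfolding W_def by blast
  have B1: "B \<subseteq> X \<times> X"
    using X1 X2[where i = "length r" and r = r for r] by (force simp: B_def)
  have B2: "W 1 p q" if "(p, q) \<in> B" for p q
  proof -
    from that obtain u r where u: "u \<in> short_words A m" "r \<in> R" "p = reduce (u @ r)" "q = reduce u"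
      by (auto simp: B_def)
    then have "area_le A R 1 (conj_word r (inv_word u))"
      by (intro area_le_conj_word) (auto simp: sym_rels_def short_words_def)
    then show ?thesis
      using area_le_cong cong[of "u @ r" u] by (force simp: W_def u conj_word_def)
  qed
  have T1: "T \<subseteq> (X \<times> X) \<times> (X \<times> X)" by (auto simp: T_def)
  have T2: "W k p' q'" if "((p, q), (p', q')) \<in> T" "W k p q" for k p q p' q'
  proof -
    from that(1) obtain s where s: "p' = reduce (p @ [s])" "q' = reduce (q @ [s])"
      by (auto simp: T_def)
    have "reduce (p' @ inv_word q') = reduce (p @ inv_word q)"
      using cong[of "p @ [s]" "q @ [s]"] reduce_pair[of p s "inv_word q"] by (simp add: s)
    then show ?thesis using that(2) area_le_cong unfolding W_def by metis
  qed
  obtain f :: "'a word \<Rightarrow> 'a word" where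
      f: "\<And>p q. p \<in> X \<Longrightarrow> q \<in> X \<Longrightarrow> f p = f q \<Longrightarrow> W (3 ^ card X) p q"
    and fB: "\<And>p q. (p, q) \<in> B \<Longrightarrow> f p = f q"
    and fT: "\<And>p q p' q'. ((p, q), (p', q')) \<in> T \<Longrightarrow> f p = f q \<Longrightarrow> f p' = f q'"
  proof -
    show thesis
      by (rule ex_closed_colouring[of X W B T])
        (fact fin W0 W_sym W_trans W_mono B1 B2 T1 T2 that)+
  qed
  \<comment> \<open>Closure under \<open>T\<close> is exactly determinism.\<close>
  have det: "b = c" if "folded_edge X f a s b" "folded_edge X f a s c" for s a b c
  proof -
    from that obtain p q where pq: "p \<in> X" "reduce (p @ [s]) \<in> X" "f p = a" "f (reduce (p @ [s])) = b"
      "q \<in> X" "reduce (q @ [s]) \<in> X" "f q = a" "f (reduce (q @ [s])) = c"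
      unfolding folded_edge_def by blast
    then have "((p, q), (reduce (p @ [s]), reduce (q @ [s]))) \<in> T" unfolding T_def by blast
    then show ?thesis using fT pq by metis
  qed
  have "[] \<in> X" using X1[of "[]"] by (simp add: short_words_def)
  have loop: "folded_path X f (f []) (conj_word r x) (f [])"
    if "r \<in> R" "x \<in> words A" "length x \<le> m" for r x
  proof -
    let ?u = "inv_word x"
    have u: "?u \<in> short_words A m" using that by (simp add: short_words_def)
    have take: "take i ?u \<in> short_words A m" for i
      using u append_take_drop_id[of i ?u] words_append[of "take i ?u" "drop i ?u" A]
      by (auto simp: short_words_def)
    have 1: "folded_path X f (f []) ?u (f (reduce ?u))"
      using folded_path_of_prefixes[of ?u "[]" X f] X1[OF take] by simp
    have "folded_path X f (f (reduce ?u)) r (f (reduce (?u @ r)))"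
      by (rule folded_path_of_prefixes) (rule X2[OF u \<open>r \<in> R\<close>])
    moreover have "f (reduce (?u @ r)) = f (reduce ?u)"
      using u that by (intro fB) (auto simp: B_def)
    ultimately show ?thesis
      \<comment> \<open>The way back along \<open>x\<close> is the outward path reversed.\<close>
      using 1 folded_path_inv_word[OF nf 1] by (simp add: conj_word_def folded_path_append) metis
  qed
  have loop': "folded_path X f (f []) (conj_word r x) (f [])"
    if r: "r \<in> sym_rels R" and x: "x \<in> words A" "length x \<le> m" for r x
  proof (cases "r \<in> R")
    case False
    with r obtain r' where "r' \<in> R" "r = inv_word r'" by (auto simp: sym_rels_def)
    then show ?thesis
      using folded_path_inv_word[OF nf loop[of r' x]] x by (simp add: inv_conj_word)
  qed (use loop x in blast)
  have ps': "set ps \<subseteq> sym_rels R \<times> words A" "free_eq A w (conj_product ps)"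
    using ps(1) by (auto simp: is_conj_product_def)
  have path: "folded_path X f (f []) (conj_product ps) (f [])"
    using ps'(1) ps(2) by (induction ps) (auto simp: folded_path_append intro: loop')
  have "sym_rels R \<subseteq> words A" using assms(3) by (auto simp: sym_rels_def)
  then have "conj_product ps \<in> words A"
    using ps'(1) by (induction ps) auto
  then have "folded_path X f (f []) (reduce (conj_product ps)) (f [])"
    using path by (rule folded_path_reduce[where A = A, rotated 2]) (fact nf, rule det)
  \<comment> \<open>The word \<open>w\<close> itself may leave the folded graph; only its reduced
    form is known to label a loop.\<close>
  then have path': "folded_path X f (f []) (reduce w) (f [])"
    using free_eq_imp_reduce_eq[OF ps'(2)] by simp
  have "area_le A R (3 ^ card X * (length (reduce w) + 1)) ([] @ reduce w @ inv_word [])"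
    by (rule area_le_folded_path[where X = X and f = f]) (fact f[unfolded W_def] path' \<open>[] \<in> X\<close>)+
  then have "area_le A R (3 ^ card X * (length (reduce w) + 1)) w"
    by (rule area_le_cong) simp
  then show ?thesis
    unfolding X_def[symmetric] by (rule area_le_mono) (simp add: length_reduce)
qed

theorem theorem4p1:
  fixes A :: "'a set" and R :: "'a word set" and P d :: "nat \<Rightarrow> nat" and C c :: nat
  assumes "finite A" and "finite R" and "R \<subseteq> words A" and "[] \<notin> R"
    and "min_isoperimetric A R P" and "min_isodiametric A R d"
    and "C = 2 * (2 * card A + 1) * (rels_norm R)\<^sup>2" and "c = (2 * card A)\<^sup>2"
  shows "\<forall>n. P n \<le> n * 2 ^ (C * c ^ d n)"
proof
  fix n
  let ?b = "n * 2 ^ (C * c ^ d n)"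
  have bound: "\<exists>qs. is_conj_product A R w qs \<and> length qs \<le> ?b"
    if w: "w \<in> words A" "group_eq A R w []" "length w = n" for w
  proof -
    obtain ps where ps: "is_conj_product A R w ps" "\<forall>(r, x)\<in>set ps. length x \<le> d n"
      using assms(6) w unfolding min_isodiametric_def isodiametric_def by metis
    consider "w = []" | "R = {}" | "w \<noteq> []" "R \<noteq> {}" by blast
    then show ?thesis
    proof cases
      \<comment> \<open>For \<open>n = 0\<close> the bound is 0, which the empty product
        meets.\<close>
      case 1
      then show ?thesis
        by (intro exI[of _ "[]"]) (simp add: is_conj_product_def group_eq_def)
    next
      case 2
      then have "ps = []" using ps(1) by (auto simp: is_conj_product_def sym_rels_def)
      then show ?thesis using ps(1) by auto
    next
      case 3
      then obtain r where r: "r \<in> R" "r \<noteq> []" using assms(4) by auto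
      then have "A \<noteq> {}" using assms(3) by (cases r) auto
      have "length r \<le> rels_norm R"
        unfolding rels_norm_def using r assms(2) by (intro member_le_sum) auto
      then have "rels_norm R > 0" using r by (cases r) auto
      let ?K = "card (fold_vertices A R (d n))"
      \<comment> \<open>As \<open>A\<close> is nonempty, 3 is at most
        \<open>2 * card A + 1\<close>.\<close>
      have "3 * (rels_norm R)\<^sup>2 * ((2 * card A) ^ d n)\<^sup>2
          \<le> ((2 * card A + 1) * (rels_norm R)\<^sup>2) * c ^ d n"
        unfolding assms(8) power_mult[symmetric] mult.commute[of "d n"]
        using \<open>A \<noteq> {}\<close> assms(1) by (intro mult_le_mono) (simp_all add: Suc_le_eq card_gt_0_iff)
      then have K: "?K + 1 \<le> (2 * card A + 1) * (rels_norm R)\<^sup>2 * c ^ d n"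
        using card_fold_vertices[OF assms(1,2) \<open>A \<noteq> {}\<close> \<open>rels_norm R > 0\<close>, of "d n"] by linarith
      have "n \<ge> 1" using 3 w by (cases w) auto
      \<comment> \<open>The factor \<open>n + 1\<close> is at most \<open>3 * n\<close>, and this 3
        raises the exponent by one. Passing from base 3 to 4 = 2^2 then produces the leading 2 in
        \<open>C\<close>.\<close>
      then have "3 ^ ?K * (n + 1) \<le> 3 ^ ?K * (3 * n)" by (intro mult_le_mono) auto
      also have "\<dots> = n * 3 ^ (?K + 1)" by simp
      also have "\<dots> \<le> n * 4 ^ (?K + 1)" by (intro mult_le_mono power_mono) auto
      also have "\<dots> \<le> n * 4 ^ ((2 * card A + 1) * (rels_norm R)\<^sup>2 * c ^ d n)"
        using K by (intro mult_le_mono power_increasing) auto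
      also have "\<dots> = n * (2\<^sup>2) ^ ((2 * card A + 1) * (rels_norm R)\<^sup>2 * c ^ d n)" by simp
      also have "\<dots> = ?b" unfolding assms(7) power_mult[symmetric] by (simp add: mult.assoc)
      finally have "area_le A R ?b w"
        using area_le_of_bounded_conjugators[OF assms(1,2,3) w(1) ps] area_le_mono w(3) by blast
      then obtain qs where qs: "set qs \<subseteq> sym_rels R \<times> words A" "length qs \<le> ?b"
        "reduce w = reduce (conj_product qs)"
        unfolding area_le_def by blast
      have "sym_rels R \<subseteq> words A" using assms(3) by (auto simp: sym_rels_def)
      then have "conj_product qs \<in> words A" using qs(1) by (induction qs) auto
      then show ?thesis
        using qs w(1) free_eq_iff_reduce_eq unfolding is_conj_product_def by blast
    qed
  qed
  have "isoperimetric A R P" and min: "\<And>Q n. isoperimetric A R Q \<Longrightarrow> P n \<le> Q n"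
    using assms(5) by (auto simp: min_isoperimetric_def)
  \<comment> \<open>Changing \<open>P\<close> at the single argument \<open>n\<close> gives a
    competitor, since only words of length \<open>n\<close> are affected.\<close>
  then have "isoperimetric A R (P(n := ?b))"
    using bound unfolding isoperimetric_def by simp
  from min[OF this, of n] show "P n \<le> ?b" by simp
qed

end
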